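(* Let $X$ be a real Hilbert space, $m\in\mathbb{N}$, $I:=\{1,\ldots,m\}$, let $T_i:X\to X$, $i\in I$, be cutters with fixed point sets $F_i$, such that $F:=\bigcap_{i\in I}F_i\neq\emptyset$. Let $w:I\to[0,1]$ be a weight function, let $\widehat{I}_w:=\{i\in I\mid w(i)>0\}$, and let $\widehat{w}:\widehat{I}_w\to(0,1]$ be the restriction of $w$ to $\widehat{I}_w$. Let $x\in X$ with $x\notin\bigcap_{i\in\widehat{I}_w}F_i$, and let $$\widehat{\lambda}_{x,\widehat{w}}:=\frac{\sum_{i\in\widehat{I}_w}\widehat{w}(i)\|T_i(x)-x\|^2}{\left\|\sum_{i\in\widehat{I}_w}\widehat{w}(i)(T_i(x)-x)\right\|^2}.$$ If $\lambda\in[0,\widehat{\lambda}_{x,\widehat{w}}]$, then $F\subseteq H(x,T_{w,\lambda}(x))$.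
   Context: An operator $T:X\to X$ on a real Hilbert space is called a cutter if $\mathrm{Fix}(T):=\{x\in X\mid T(x)=x\}\neq\emptyset$ and $\langle x-T(x),q-T(x)\rangle\le 0$ for all $x\in X$ and all $q\in\mathrm{Fix}(T)$. A weight function on $I$ is a function $w:I\to[0,1]$ with $\sum_{i\in I}w(i)=1$. Put $T_w(x):=\sum_{i\in I}w(i)T_i(x)$ and, for $\lambda\in\mathbb{R}$, $T_{w,\lambda}(x):=x+\lambda(T_w(x)-x)$. For $x,y\in X$, $H(x,y):=\{u\in X\mid\langle x-y,u-y\rangle\le 0\}$. Under the stated hypotheses the denominator in the definition of $\widehat{\lambda}_{x,\widehat{w}}$ is nonzero. *)

theory Defs
  imports "HOL-Analysis.Analysis"
begin

text \<open>
  Real Hilbert spaces are types of sort \<open>{real_inner, complete_space}\<close>.  Finite families are functions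
  on \<open>nat\<close> of which only the values on the explicit index set matter.
\<close>

definition Fix :: "('a \<Rightarrow> 'a) \<Rightarrow> 'a set"
  where "Fix T = {x. T x = x}"

definition cutter :: "('a::real_inner \<Rightarrow> 'a) \<Rightarrow> bool"
  where "cutter T \<longleftrightarrow> Fix T \<noteq> {} \<and> (\<forall>x. \<forall>q\<in>Fix T. (x - T x) \<bullet> (q - T x) \<le> 0)"

definition weight_function :: "'i set \<Rightarrow> ('i \<Rightarrow> real) \<Rightarrow> bool"
  where "weight_function I w \<longleftrightarrow> (\<forall>i\<in>I. w i \<in> {0..1}) \<and> (\<Sum>i\<in>I. w i) = 1"

definition active :: "'i set \<Rightarrow> ('i \<Rightarrow> real) \<Rightarrow> 'i set"
  where "active I w = {i \<in> I. w i > 0}"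

definition weighted_op ::
    "'i set \<Rightarrow> ('i \<Rightarrow> 'a::real_vector \<Rightarrow> 'a) \<Rightarrow> ('i \<Rightarrow> real) \<Rightarrow> 'a \<Rightarrow> 'a"
  where "weighted_op I T w x = (\<Sum>i\<in>I. w i *\<^sub>R T i x)"

definition relaxed_weighted_op ::
    "'i set \<Rightarrow> ('i \<Rightarrow> 'a::real_vector \<Rightarrow> 'a) \<Rightarrow> ('i \<Rightarrow> real) \<Rightarrow> real \<Rightarrow> 'a \<Rightarrow> 'a"
  where "relaxed_weighted_op I T w l x = x + l *\<^sub>R (weighted_op I T w x - x)"

text \<open>Equal to the whole space if \<open>x = y\<close>.\<close>

definition H :: "'a::real_inner \<Rightarrow> 'a \<Rightarrow> 'a set"
  where "H x y = {u. (x - y) \<bullet> (u - y) \<le> 0}"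

text \<open>
  The denominator is nonzero whenever the operators are cutters with a common fixed point, \<open>v\<close> is a
  positive weight function on \<open>J\<close> and \<open>x\<close> is not a fixed point of all \<open>T i\<close>, \<open>i \<in> J\<close>; so the convention
  for division by zero plays no role there.
\<close>

definition lambda_hat ::
    "'i set \<Rightarrow> ('i \<Rightarrow> 'a::real_normed_vector \<Rightarrow> 'a) \<Rightarrow> 'a \<Rightarrow> ('i \<Rightarrow> real) \<Rightarrow> real"
  where "lambda_hat J T x v =
    (\<Sum>i\<in>J. v i * (norm (T i x - x))\<^sup>2) / (norm (\<Sum>i\<in>J. v i *\<^sub>R (T i x - x)))\<^sup>2"

end

theory Submission
  imports Defs
begin

text \<open>
  Let \<open>d = (\<Sum>i. w i *\<^sub>R (T i x - x))\<close> be the averaged displacement and \<open>q\<close> a common fixed point.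
  The cutter inequality says that the inner product of a single displacement with \<open>q - x\<close> is at least
  its squared length (\<open>cutter_displacement\<close>).  The inner product is linear in the displacement, so
  averaging gives \<open>d \<bullet> (q - x) \<ge> (\<Sum>i. w i * (norm (T i x - x))\<^sup>2)\<close>.  On the other hand, a step
  \<open>l *\<^sub>R d\<close> with \<open>l \<ge> 0\<close> stops before the hyperplane through \<open>q\<close> orthogonal to \<open>d\<close>, and so keeps \<open>q\<close> in
  \<open>H x (x + l *\<^sub>R d)\<close>, as soon as \<open>l * (norm d)\<^sup>2 \<le> d \<bullet> (q - x)\<close> (\<open>step_mem_H\<close>).  The step size
  \<open>lambda_hat\<close> is the one for which \<open>l * (norm d)\<^sup>2\<close> equals the averaged squared length, a lower bound
  of \<open>d \<bullet> (q - x)\<close> for every \<open>q\<close> at once.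
\<close>

lemma cutter_displacement:
  assumes "cutter T" and "q \<in> Fix T"
  shows "(norm (T x - x))\<^sup>2 \<le> (T x - x) \<bullet> (q - x)"
proof -
  have "(x - T x) \<bullet> (q - T x) \<le> 0"
    using assms by (simp add: cutter_def)
  moreover have "(x - T x) \<bullet> (q - T x) = (norm (T x - x))\<^sup>2 - (T x - x) \<bullet> (q - x)"
    by (simp add: power2_norm_eq_inner inner_diff inner_commute)
  ultimately show ?thesis by simp
qed

lemma step_mem_H:
  assumes "0 \<le> l" and "l * (norm d)\<^sup>2 \<le> d \<bullet> (q - x)"
  shows "q \<in> H x (x + l *\<^sub>R d)"
proof -
  have "(x - (x + l *\<^sub>R d)) \<bullet> (q - (x + l *\<^sub>R d)) = - (l * (d \<bullet> (q - x) - l * (norm d)\<^sup>2))"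
    by (simp add: power2_norm_eq_inner algebra_simps inner_diff inner_add)
  also have "\<dots> \<le> 0"
    using assms by simp
  finally show ?thesis by (simp add: H_def)
qed

text \<open>The weights add up to 1, so \<open>x\<close> can be moved into the average, where zero weights drop out.\<close>

lemma weighted_op_displacement:
  assumes "finite I" and "weight_function I w"
  shows "weighted_op I T w x - x = (\<Sum>i\<in>active I w. w i *\<^sub>R (T i x - x))"
proof -
  have "weighted_op I T w x - x = (\<Sum>i\<in>I. w i *\<^sub>R T i x) - (\<Sum>i\<in>I. w i) *\<^sub>R x"
    using assms by (simp add: weighted_op_def weight_function_def)
  also have "\<dots> = (\<Sum>i\<in>I. w i *\<^sub>R (T i x - x))"
    by (simp add: scaleR_sum_left scaleR_diff_right sum_subtractf)
  also have "\<dots> = (\<Sum>i\<in>active I w. w i *\<^sub>R (T i x - x))"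
  proof (rule sum.mono_neutral_right)
    show "\<forall>i\<in>I - active I w. w i *\<^sub>R (T i x - x) = 0"
      using assms(2) by (force simp: active_def weight_function_def)
  qed (use assms in \<open>auto simp: active_def\<close>)
  finally show ?thesis .
qed

lemma lambda_hat_bound:
  assumes "\<And>i. i \<in> J \<Longrightarrow> 0 \<le> v i" and "l \<le> lambda_hat J T x v"
  shows "l * (norm (\<Sum>i\<in>J. v i *\<^sub>R (T i x - x)))\<^sup>2 \<le> (\<Sum>i\<in>J. v i * (norm (T i x - x))\<^sup>2)"
proof (cases "(\<Sum>i\<in>J. v i *\<^sub>R (T i x - x)) = 0")
  case True
  then show ?thesis using assms(1) by (simp add: sum_nonneg)
next
  case False
  then show ?thesis using assms(2) by (simp add: lambda_hat_def pos_le_divide_eq)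
qed

theorem lemma3p11:
  fixes m :: nat
    and T :: "nat \<Rightarrow> 'a::{real_inner, complete_space} \<Rightarrow> 'a"
    and w :: "nat \<Rightarrow> real"
    and x :: 'a
    and l :: real
  assumes "\<And>i. i \<in> {1..m} \<Longrightarrow> cutter (T i)"
    and "(\<Inter>i\<in>{1..m}. Fix (T i)) \<noteq> {}"
    and "weight_function {1..m} w"
    and "x \<notin> (\<Inter>i\<in>active {1..m} w. Fix (T i))"
    and "l \<in> {0..lambda_hat (active {1..m} w) T x (restrict w (active {1..m} w))}"
  shows "(\<Inter>i\<in>{1..m}. Fix (T i)) \<subseteq> H x (relaxed_weighted_op {1..m} T w l x)"
proof
  fix q
  assume q: "q \<in> (\<Inter>i\<in>{1..m}. Fix (T i))"
  define J where "J = active {1..m} w"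
  define d where "d = (\<Sum>i\<in>J. w i *\<^sub>R (T i x - x))"
  have J: "i \<in> {1..m}" "0 \<le> w i" if "i \<in> J" for i
    using that by (auto simp: J_def active_def)
  have "l * (norm d)\<^sup>2 \<le> (\<Sum>i\<in>J. w i * (norm (T i x - x))\<^sup>2)"
    using lambda_hat_bound[of J "restrict w J" l T x] assms(5) J(2) by (simp add: J_def d_def)
  also have "\<dots> \<le> (\<Sum>i\<in>J. w i * ((T i x - x) \<bullet> (q - x)))"
    using J q assms(1) by (intro sum_mono mult_left_mono cutter_displacement) auto
  also have "\<dots> = d \<bullet> (q - x)"
    by (simp add: d_def inner_sum_left)
  finally have "q \<in> H x (x + l *\<^sub>R d)"
    using assms(5) by (intro step_mem_H) auto
  then show "q \<in> H x (relaxed_weighted_op {1..m} T w l x)"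
    using weighted_op_displacement[of "{1..m}" w T x] assms(3)
    by (simp add: relaxed_weighted_op_def J_def d_def)
qed

end
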